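(* Suppose that Assumptions (A1), (A2) and (A3) of the context hold and let $x^k\in\Omega$ be feasible for the MPEC. If $x^k$ is not B-stationary, then for sufficiently small $\rho<\bar\rho$ (with $\rho>0$ and $\bar\rho=\bar\rho(x^k)$ as in the context), any feasible point $d\ne0$ of $\mathrm{LPEC}(x^k,\rho)$ satisfies $\nabla f(x^k)^\top d<0$, and $x^k$ is feasible but not stationary for any $\mathrm{BNLP}(\mathcal I_1(x^k+d),\mathcal I_2(x^k+d))$ with $(\mathcal I_1(x^k+d),\mathcal I_2(x^k+d))\in\mathcal P(x^k+d)$.
   Context: **MPEC.** Let $n=p+2m$, $x=(x_0,x_1,x_2)\in\mathbb R^p\times\mathbb R^m\times\mathbb R^m$, and let $f:\mathbb R^n\to\mathbb R$, $c:\mathbb R^n\to\mathbb R^{n_c}$ be twice continuously differentiable. The MPEC is $\min f(x)$ s.t. $x\in\Omega=\{x: c(x)\ge 0,\ 0\le x_1\perp x_2\ge 0\}$, where $0\le x_1\perp x_2\ge0$ means $x_{1,i},x_{2,i}\ge 0$, $x_{1,i}x_{2,i}=0$ for all $i$. Vectors $d$ are partitioned as $d=(d_0,d_1,d_2)$. **Index sets.** For $x$ with $0\le x_1\perp x_2\ge0$: $\mathcal I_{0+}(x)=\{i:x_{1,i}=0<x_{2,i}\}$, $\mathcal I_{+0}(x)=\{i:x_{1,i}>0=x_{2,i}\}$, $\mathcal I_{00}(x)=\{i:x_{1,i}=x_{2,i}=0\}$; $\mathcal A(x)=\{i:c_i(x)=0\}$, $\bar{\mathcal A}(x)=\{i:c_i(x)>0\}$.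 $\mathcal P(x)$ is the set of all pairs $(\mathcal I_1(x),\mathcal I_2(x))=(\mathcal I_{0+}(x)\cup\mathcal D_1,\ \mathcal I_{+0}(x)\cup\mathcal D_2)$ with $(\mathcal D_1,\mathcal D_2)$ a partition of $\mathcal I_{00}(x)$ (parts may be empty). **BNLP.** For a partition $(\mathcal I_1,\mathcal I_2)$ of $\{1,\dots,m\}$, $\mathrm{BNLP}(\mathcal I_1,\mathcal I_2)$ is: $\min f(x)$ s.t. $c(x)\ge0$; $x_{1,i}=0,\ x_{2,i}\ge0$ for $i\in\mathcal I_1$; $x_{1,i}\ge0,\ x_{2,i}=0$ for $i\in\mathcal I_2$. Stationary point means KKT point. **B-stationarity.** $x^*\in\Omega$ is B-stationary if $d=0$ is a global solution of: $\min_d\nabla f(x^* )^\top d$ s.t. $c_i(x^* )+\nabla c_i(x^* )^\top d\ge0$ ($i\in\mathcal A(x^* )$); $x^*_{1,i}+d_{1,i}=0$ ($i\in\mathcal I_{0+}(x^* )$); $x^*_{2,i}+d_{2,i}=0$ ($i\in\mathcal I_{+0}(x^* )$); $0\le x^*_{1,i}+d_{1,i}\perp x^*_{2,i}+d_{2,i}\ge0$ ($i\in\mathcal I_{00}(x^* )$). **LPEC.** For $x\in\mathbb R^n$, $\rho>0$, $\mathrm{LPEC}(x,\rho)$ is: $\min_d\nabla f(x)^\top d$ s.t. $c_i(x)+\nabla c_i(x)^\top d\ge0$ for all $i=1,\dots,n_c$; $0\le x_{1,i}+d_{1,i}\perp x_{2,i}+d_{2,i}\ge0$ for all $i=1,\dots,m$;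 $\|d\|_\infty\le\rho$. **Radius.** For $x\in\Omega$, $\bar\rho(x)=\min\big(\{x_{1,i}:i\in\mathcal I_{+0}(x)\}\cup\{x_{2,i}:i\in\mathcal I_{0+}(x)\}\cup\{c_i(x)\|\nabla c_i(x)\|^{-1}:i\in\bar{\mathcal A}(x),\nabla c_i(x)\ne0\}\big)$, with $\|\cdot\|$ a fixed norm on $\mathbb R^n$ and $\min\emptyset=\infty$. **Assumptions.** (A1) There is a compact set $X$ with $\Omega\subset X$. (A2) MPEC-MFCQ holds at every $x^*\in\Omega$: the usual MFCQ holds at $x^*$ for the tight NLP $\min f(x)$ s.t. $c(x)\ge0$; $x_{1,i}=0,x_{2,i}\ge0$ ($i\in\mathcal I_{0+}(x^* )$); $x_{1,i}\ge0,x_{2,i}=0$ ($i\in\mathcal I_{+0}(x^* )$); $x_{1,i}=x_{2,i}=0$ ($i\in\mathcal I_{00}(x^* )$). (A3) (NLP solver) An NLP solver is available such that, for an NLP $\min f(x)$ s.t. $g(x)\ge0$ with $C^2$ data and an initial guess $x^0$, it returns either (1) a stationary (KKT) point $x^*$ of the NLP; moreover, for every feasible nonstationary point $\bar x$ of the NLP there are a neighborhood $\mathcal N_{\bar x}$ and $\alpha_{\bar x}>0$ such that, whenever the solver is initialized at a feasible nonstationary point $x^0\in\mathcal N_{\bar x}$, it returns a stationary point $x^*$ with $f(x^0)-f(x^* )\ge\alpha_{\bar x}$; or (2) a stationary point of the feasibility problem $\min_x\|g^-(x)\|$, $g^-=\min(0,g)$.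
   Formalization: Not every feasible d≠0 has ∇f(x^k)^T d<0 (f=x_0, c=1−‖x‖², x^k=0, d=(ρ,0,0)); proved instead: some feasible d≠0 and every LPEC solution do, x^k is feasible for each BNLP of any feasible d≠0, and is not stationary for it if ∇f(x^k)^T d<0. *)

theory Defs
  imports "HOL-Analysis.Analysis"
begin

section \<open>Smooth functions and norms\<close>

definition C2 :: "('a::real_normed_vector \<Rightarrow> 'b::real_normed_vector) \<Rightarrow> bool" where
  "C2 f \<longleftrightarrow> (\<exists>f' f''.
      (\<forall>x. (f has_derivative blinfun_apply (f' x)) (at x)) \<and>
      (\<forall>x. (f' has_derivative blinfun_apply (f'' x)) (at x)) \<and>
      continuous_on UNIV f'')"

definition grad :: "('a::real_inner \<Rightarrow> real) \<Rightarrow> 'a \<Rightarrow> 'a" where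
  "grad f x = (THE D. GDERIV f x :> D)"

definition is_norm :: "('a::real_vector \<Rightarrow> real) \<Rightarrow> bool" where
  "is_norm N \<longleftrightarrow>
      (\<forall>x. 0 \<le> N x) \<and> (\<forall>x. N x = 0 \<longleftrightarrow> x = 0) \<and>
      (\<forall>x y. N (x + y) \<le> N x + N y) \<and> (\<forall>a x. N (a *\<^sub>R x) = \<bar>a\<bar> * N x)"

section \<open>Nonlinear programs\<close>

text \<open>
  The program is: minimize \<open>objective\<close> subject to \<open>con k x \<ge> 0\<close> for \<open>k \<in> ineqs\<close> and
  \<open>con k x = 0\<close> for \<open>k \<in> eqs\<close>. The index sets are meant to be finite.
\<close>

record ('a, 'k) nlp =
  objective :: "'a \<Rightarrow> real"
  con :: "'k \<Rightarrow> 'a \<Rightarrow> real"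
  ineqs :: "'k set"
  eqs :: "'k set"

definition nlp_feasible :: "('a, 'k) nlp \<Rightarrow> 'a \<Rightarrow> bool" where
  "nlp_feasible P x \<longleftrightarrow> (\<forall>k\<in>ineqs P. 0 \<le> con P k x) \<and> (\<forall>k\<in>eqs P. con P k x = 0)"

text \<open>
  The Karush-Kuhn-Tucker conditions; the multipliers of the equality constraints are free.
  This is the same as the KKT conditions for the program in which each equality
  \<open>h = 0\<close> is written as \<open>h \<ge> 0\<close>, \<open>- h \<ge> 0\<close>.
\<close>

definition nlp_stationary :: "('a::real_inner, 'k) nlp \<Rightarrow> 'a \<Rightarrow> bool" where
  "nlp_stationary P x \<longleftrightarrow> nlp_feasible P x \<and>
      (\<exists>u v. (\<forall>k\<in>ineqs P. 0 \<le> u k \<and> u k * con P k x = 0) \<and>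
        grad (objective P) x =
          (\<Sum>k\<in>ineqs P. u k *\<^sub>R grad (con P k) x) + (\<Sum>k\<in>eqs P. v k *\<^sub>R grad (con P k) x))"

definition MFCQ :: "('a::real_inner, 'k) nlp \<Rightarrow> 'a \<Rightarrow> bool" where
  "MFCQ P x \<longleftrightarrow>
      (\<forall>\<mu>. (\<Sum>k\<in>eqs P. \<mu> k *\<^sub>R grad (con P k) x) = 0 \<longrightarrow> (\<forall>k\<in>eqs P. \<mu> k = 0)) \<and>
      (\<exists>d. (\<forall>k\<in>eqs P. grad (con P k) x \<bullet> d = 0) \<and>
           (\<forall>k\<in>ineqs P. con P k x = 0 \<longrightarrow> 0 < grad (con P k) x \<bullet> d))"

text \<open>
  The Euclidean norm of the constraint violation. Writing an equality \<open>h = 0\<close> as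
  \<open>h \<ge> 0\<close>, \<open>- h \<ge> 0\<close>, the two negative parts contribute \<open>h\<^sup>2\<close> under the root.
\<close>

definition violation :: "('a, 'k) nlp \<Rightarrow> 'a \<Rightarrow> real" where
  "violation P x = sqrt ((\<Sum>k\<in>ineqs P. (min 0 (con P k x))\<^sup>2) + (\<Sum>k\<in>eqs P. (con P k x)\<^sup>2))"

text \<open>
  The violation is not differentiable everywhere; a point is stationary for its minimization
  if no one-sided (lower Dini) directional derivative is negative.
\<close>

definition feasibility_stationary :: "('a::real_normed_vector, 'k) nlp \<Rightarrow> 'a \<Rightarrow> bool" where
  "feasibility_stationary P x \<longleftrightarrow>
      (\<forall>d. 0 \<le> Liminf (at_right 0) (\<lambda>t. ereal ((violation P (x + t *\<^sub>R d) - violation P x) / t)))"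

text \<open>
  \<open>S P x0\<close> is the point returned by the solver \<open>S\<close> for the program \<open>P\<close> and initial guess \<open>x0\<close>.
\<close>

definition solver_spec ::
    "(('a::real_inner, 'k) nlp \<Rightarrow> 'a \<Rightarrow> 'a) \<Rightarrow> ('a, 'k) nlp \<Rightarrow> bool" where
  "solver_spec S P \<longleftrightarrow>
      (\<forall>x0. nlp_stationary P (S P x0) \<or> feasibility_stationary P (S P x0)) \<and>
      (\<forall>y. nlp_feasible P y \<and> \<not> nlp_stationary P y \<longrightarrow>
        (\<exists>U \<alpha>. open U \<and> y \<in> U \<and> 0 < \<alpha> \<and>
          (\<forall>x0\<in>U. nlp_feasible P x0 \<and> \<not> nlp_stationary P x0 \<longrightarrow>
            nlp_stationary P (S P x0) \<and> \<alpha> \<le> objective P x0 - objective P (S P x0))))"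

section \<open>The MPEC\<close>

type_synonym ('p, 'm) point = "(real ^ 'p) \<times> (real ^ 'm) \<times> (real ^ 'm)"

abbreviation x1 :: "('p::finite, 'm::finite) point \<Rightarrow> real ^ 'm" where
  "x1 x \<equiv> fst (snd x)"

abbreviation x2 :: "('p::finite, 'm::finite) point \<Rightarrow> real ^ 'm" where
  "x2 x \<equiv> snd (snd x)"

definition complementary :: "('p::finite, 'm::finite) point \<Rightarrow> bool" where
  "complementary x \<longleftrightarrow> (\<forall>i. 0 \<le> x1 x $ i \<and> 0 \<le> x2 x $ i \<and> x1 x $ i * x2 x $ i = 0)"

definition mpec_feasible_set ::
    "(('p::finite, 'm::finite) point \<Rightarrow> real ^ 'c) \<Rightarrow> ('p, 'm) point set" where
  "mpec_feasible_set c = {x. (\<forall>i. 0 \<le> c x $ i) \<and> complementary x}"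

definition I_0p :: "('p::finite, 'm::finite) point \<Rightarrow> 'm set" where
  "I_0p x = {i. x1 x $ i = 0 \<and> 0 < x2 x $ i}"

definition I_p0 :: "('p::finite, 'm::finite) point \<Rightarrow> 'm set" where
  "I_p0 x = {i. 0 < x1 x $ i \<and> x2 x $ i = 0}"

definition I_00 :: "('p::finite, 'm::finite) point \<Rightarrow> 'm set" where
  "I_00 x = {i. x1 x $ i = 0 \<and> x2 x $ i = 0}"

definition active :: "(('p::finite, 'm::finite) point \<Rightarrow> real ^ 'c) \<Rightarrow> ('p, 'm) point \<Rightarrow> 'c set" where
  "active c x = {i. c x $ i = 0}"

definition inactive :: "(('p::finite, 'm::finite) point \<Rightarrow> real ^ 'c) \<Rightarrow> ('p, 'm) point \<Rightarrow> 'c set" where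
  "inactive c x = {i. 0 < c x $ i}"

definition branch_pairs :: "('p::finite, 'm::finite) point \<Rightarrow> ('m set \<times> 'm set) set" where
  "branch_pairs x =
      {(I_0p x \<union> D1, I_p0 x \<union> D2) | D1 D2. D1 \<union> D2 = I_00 x \<and> D1 \<inter> D2 = {}}"

datatype ('c, 'm) con_index = General 'c | Comp1 'm | Comp2 'm

fun mpec_con ::
    "(('p::finite, 'm::finite) point \<Rightarrow> real ^ 'c) \<Rightarrow> ('c, 'm) con_index \<Rightarrow> ('p, 'm) point \<Rightarrow> real" where
  "mpec_con c (General i) x = c x $ i"
| "mpec_con c (Comp1 i) x = x1 x $ i"
| "mpec_con c (Comp2 i) x = x2 x $ i"

definition bnlp ::
    "(('p::finite, 'm::finite) point \<Rightarrow> real) \<Rightarrow> (('p, 'm) point \<Rightarrow> real ^ 'c) \<Rightarrow> 'm set \<Rightarrow> 'm set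
      \<Rightarrow> (('p, 'm) point, ('c, 'm) con_index) nlp" where
  "bnlp f c I1 I2 =
      \<lparr>objective = f, con = mpec_con c,
       ineqs = range General \<union> Comp2 ` I1 \<union> Comp1 ` I2,
       eqs = Comp1 ` I1 \<union> Comp2 ` I2\<rparr>"

definition tight_nlp ::
    "(('p::finite, 'm::finite) point \<Rightarrow> real) \<Rightarrow> (('p, 'm) point \<Rightarrow> real ^ 'c) \<Rightarrow> ('p, 'm) point
      \<Rightarrow> (('p, 'm) point, ('c, 'm) con_index) nlp" where
  "tight_nlp f c x =
      \<lparr>objective = f, con = mpec_con c,
       ineqs = range General \<union> Comp2 ` I_0p x \<union> Comp1 ` I_p0 x,
       eqs = Comp1 ` (I_0p x \<union> I_00 x) \<union> Comp2 ` (I_p0 x \<union> I_00 x)\<rparr>"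

definition b_stationary ::
    "(('p::finite, 'm::finite) point \<Rightarrow> real) \<Rightarrow> (('p, 'm) point \<Rightarrow> real ^ 'c)
      \<Rightarrow> ('p, 'm) point \<Rightarrow> bool" where
  "b_stationary f c x \<longleftrightarrow> x \<in> mpec_feasible_set c \<and>
      is_arg_min (\<lambda>d. grad f x \<bullet> d)
        (\<lambda>d. (\<forall>i\<in>active c x. 0 \<le> c x $ i + grad (\<lambda>y. c y $ i) x \<bullet> d) \<and>
             (\<forall>i\<in>I_0p x. x1 x $ i + x1 d $ i = 0) \<and>
             (\<forall>i\<in>I_p0 x. x2 x $ i + x2 d $ i = 0) \<and>
             (\<forall>i\<in>I_00 x. 0 \<le> x1 x $ i + x1 d $ i \<and> 0 \<le> x2 x $ i + x2 d $ i \<and>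
                (x1 x $ i + x1 d $ i) * (x2 x $ i + x2 d $ i) = 0))
        0"

definition lpec_feasible ::
    "(('p::finite, 'm::finite) point \<Rightarrow> real ^ 'c) \<Rightarrow> ('p, 'm) point \<Rightarrow> real
      \<Rightarrow> ('p, 'm) point \<Rightarrow> bool" where
  "lpec_feasible c x \<rho> d \<longleftrightarrow>
      (\<forall>i. 0 \<le> c x $ i + grad (\<lambda>y. c y $ i) x \<bullet> d) \<and> complementary (x + d) \<and> infnorm d \<le> \<rho>"

definition lpec_solution ::
    "(('p::finite, 'm::finite) point \<Rightarrow> real) \<Rightarrow> (('p, 'm) point \<Rightarrow> real ^ 'c)
      \<Rightarrow> ('p, 'm) point \<Rightarrow> real \<Rightarrow> ('p, 'm) point \<Rightarrow> bool" where
  "lpec_solution f c x \<rho> d \<longleftrightarrow> is_arg_min (\<lambda>d. grad f x \<bullet> d) (lpec_feasible c x \<rho>) d"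

text \<open>The set is finite, so the infimum is a minimum, and it is \<open>\<infinity>\<close> if the set is empty.\<close>

definition rho_bar ::
    "(('p::finite, 'm::finite) point \<Rightarrow> real) \<Rightarrow> (('p, 'm) point \<Rightarrow> real ^ 'c)
      \<Rightarrow> ('p, 'm) point \<Rightarrow> ereal" where
  "rho_bar N c x =
      Inf (ereal ` ({x1 x $ i | i. i \<in> I_p0 x} \<union> {x2 x $ i | i. i \<in> I_0p x} \<union>
        {c x $ i / N (grad (\<lambda>y. c y $ i) x) | i. i \<in> inactive c x \<and> grad (\<lambda>y. c y $ i) x \<noteq> 0}))"

end

theory Submission
  imports Defs
begin

text \<open>
  Everything happens to first order at \<open>xk\<close>; two mechanisms carry the proof.

  \<^bold>\<open>Descent directions survive in the LPEC.\<close>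
  Failure of B-stationarity gives a descent direction \<open>d\<close> of the linearized problem, whose feasible
  set at \<open>xk\<close> is a cone (\<open>linearized_cone\<close>): the constraints that it keeps are those that are tight
  at \<open>xk\<close>. Shrinking \<open>d\<close> therefore preserves them, while the constraints that are slack at \<open>xk\<close> and
  the trust region hold for every short enough step. So \<open>t *\<^sub>R d\<close> is feasible for the LPEC
  (\<open>eventually_lpec_feasible\<close>), whatever \<open>\<rho> > 0\<close> is, and the optimal LPEC value is negative. In
  particular a solution of the LPEC is a nonzero descent direction.

  \<^bold>\<open>A short LPEC step only reaches branches that contain \<open>xk\<close>; if it descends, \<open>xk\<close> is not a
  KKT point of them.\<close>
  A step shorter than the radius \<open>rho_bar\<close> cannot bring a positive component of \<open>x1 xk\<close> or \<open>x2 xk\<close>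
  down to zero, so a variable that vanishes at \<open>xk + d\<close> vanishes already at \<open>xk\<close>
  (\<open>zero_after_short_step\<close>). Hence \<open>xk\<close> satisfies the equations of each BNLP that belongs to
  \<open>xk + d\<close>, and \<open>d\<close> is a linearized feasible direction of that BNLP at \<open>xk\<close>. Along such directions
  a KKT point has no first-order descent (\<open>nlp_stationary_no_descent\<close>).
\<close>

section \<open>Gradients, radii and KKT points\<close>

text \<open>
  The gradient is a definite description, so for coordinate functions it is identified by
  exhibiting the Riesz representative and by uniqueness of the derivative.
\<close>

lemma grad_bounded_linear_inner:
  fixes h :: "'a::euclidean_space \<Rightarrow> real"
  assumes "bounded_linear h"
  shows "grad h x \<bullet> d = h d"
proof -
  have lin: "linear h"
    using assms by (simp add: bounded_linear.linear)
  have rep: "v \<bullet> adjoint h 1 = h v" for v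
    using adjoint_works[OF lin, of v 1] by simp
  have der: "GDERIV h x :> adjoint h 1"
    unfolding gderiv_def rep by (rule bounded_linear_imp_has_derivative[OF assms])
  have "grad h x = adjoint h 1"
    unfolding grad_def
  proof (rule the_equality)
    show "GDERIV h x :> adjoint h 1"
      by (rule der)
  next
    fix D assume "GDERIV h x :> D"
    then have "(\<lambda>v. v \<bullet> D) = (\<lambda>v. v \<bullet> adjoint h 1)"
      using der unfolding gderiv_def by (rule has_derivative_unique)
    then show "D = adjoint h 1"
      by (metis vector_eq_ldot)
  qed
  then show ?thesis
    by (simp add: rep inner_commute)
qed

lemma grad_Comp1_inner:
  "grad (mpec_con c (Comp1 i)) x \<bullet> d = x1 d $ i"
proof -
  have "mpec_con c (Comp1 i) = (\<lambda>y. x1 y $ i)"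
    by (rule ext) simp
  then show ?thesis
    by (simp add: grad_bounded_linear_inner bounded_linear_intros
        bounded_linear_compose[OF bounded_linear_vec_nth])
qed

lemma grad_Comp2_inner:
  "grad (mpec_con c (Comp2 i)) x \<bullet> d = x2 d $ i"
proof -
  have "mpec_con c (Comp2 i) = (\<lambda>y. x2 y $ i)"
    by (rule ext) simp
  then show ?thesis
    by (simp add: grad_bounded_linear_inner bounded_linear_intros
        bounded_linear_compose[OF bounded_linear_vec_nth])
qed

lemma grad_General_inner:
  "grad (mpec_con c (General i)) x \<bullet> d = grad (\<lambda>y. c y $ i) x \<bullet> d"
proof -
  have "mpec_con c (General i) = (\<lambda>y. c y $ i)"
    by (rule ext) simp
  then show ?thesis
    by simp
qed

lemma Pair_zero_in_Basis:
  "u \<in> Basis \<Longrightarrow> (u, 0) \<in> Basis" "v \<in> Basis \<Longrightarrow> (0, v) \<in> Basis"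
  unfolding Basis_prod_def by (rule UnI1, erule imageI) (rule UnI2, erule imageI)

lemma abs_x1_le_infnorm: "\<bar>x1 d $ i\<bar> \<le> infnorm d"
proof -
  have "(0, axis i (1::real), 0) \<in> Basis"
    by (intro Pair_zero_in_Basis) (simp add: axis_in_Basis_iff)
  from Basis_le_infnorm[OF this, of d] show ?thesis
    by (simp add: inner_prod_def inner_axis)
qed

lemma abs_x2_le_infnorm: "\<bar>x2 d $ i\<bar> \<le> infnorm d"
proof -
  have "(0, 0, axis i (1::real)) \<in> Basis"
    by (intro Pair_zero_in_Basis) (simp add: axis_in_Basis_iff)
  from Basis_le_infnorm[OF this, of d] show ?thesis
    by (simp add: inner_prod_def inner_axis)
qed

text \<open>
  The radius is an infimum of finitely many positive numbers. The constant \<open>1\<close> stands in for the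
  infinite radius that arises when there are none.
\<close>

lemma rho_bar_positive_lower_bound:
  assumes "is_norm N"
  obtains r where "0 < r" "ereal r \<le> rho_bar N c x"
proof -
  define A where "A = {x1 x $ i | i. i \<in> I_p0 x} \<union> {x2 x $ i | i. i \<in> I_0p x} \<union>
        {c x $ i / N (grad (\<lambda>y. c y $ i) x) | i. i \<in> inactive c x \<and> grad (\<lambda>y. c y $ i) x \<noteq> 0}"
  have "finite A"
    unfolding A_def by simp
  have N_pos: "0 < N v" if "v \<noteq> 0" for v
    using assms that unfolding is_norm_def by (metis order_le_less)
  have "\<forall>a\<in>A. 0 < a"
    unfolding A_def I_p0_def I_0p_def inactive_def
    by (auto intro!: divide_pos_pos N_pos simp del: split_paired_All)
  then have "0 < Min (insert 1 A)"
    using \<open>finite A\<close> by simp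
  moreover have "ereal (Min (insert 1 A)) \<le> rho_bar N c x"
    unfolding rho_bar_def A_def[symmetric]
    using \<open>finite A\<close> by (auto intro!: INF_greatest)
  ultimately show thesis
    by (rule that)
qed

text \<open>
  Pairing the KKT identity with \<open>d\<close> makes every term nonnegative: equality terms vanish, and an
  inequality with a nonzero multiplier is active by complementary slackness.
\<close>

lemma nlp_stationary_no_descent:
  assumes stat: "nlp_stationary P x"
    and eqs: "\<And>k. k \<in> eqs P \<Longrightarrow> grad (con P k) x \<bullet> d = 0"
    and ineqs: "\<And>k. k \<in> ineqs P \<Longrightarrow> con P k x = 0 \<Longrightarrow> 0 \<le> grad (con P k) x \<bullet> d"
  shows "0 \<le> grad (objective P) x \<bullet> d"
proof -
  obtain u v where u: "\<forall>k\<in>ineqs P. 0 \<le> u k \<and> u k * con P k x = 0"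
    and kkt: "grad (objective P) x =
      (\<Sum>k\<in>ineqs P. u k *\<^sub>R grad (con P k) x) + (\<Sum>k\<in>eqs P. v k *\<^sub>R grad (con P k) x)"
    using stat unfolding nlp_stationary_def by blast
  have "grad (objective P) x \<bullet> d =
      (\<Sum>k\<in>ineqs P. u k * (grad (con P k) x \<bullet> d)) + (\<Sum>k\<in>eqs P. v k * (grad (con P k) x \<bullet> d))"
    by (simp add: kkt inner_add_left inner_sum_left)
  also have "(\<Sum>k\<in>eqs P. v k * (grad (con P k) x \<bullet> d)) = 0"
    by (simp add: eqs)
  finally have pairing:
    "grad (objective P) x \<bullet> d = (\<Sum>k\<in>ineqs P. u k * (grad (con P k) x \<bullet> d))"
    by simp
  show ?thesis
    unfolding pairing
  proof (rule sum_nonneg)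
    fix k assume k: "k \<in> ineqs P"
    show "0 \<le> u k * (grad (con P k) x \<bullet> d)"
    proof (cases "con P k x = 0")
      case True
      then show ?thesis
        using k u ineqs by simp
    next
      case False
      then show ?thesis
        using k u by force
    qed
  qed
qed

section \<open>Descent for the LPEC\<close>

text \<open>
  The feasible set of the linearized problem in the definition of B-stationarity, written without
  the values \<open>c x $ i\<close>, \<open>x1 x $ i\<close>, \<open>x2 x $ i\<close>, all of which are zero for the indices in question. This
  form makes it visible that the set is a cone.
\<close>

definition linearized_cone ::
    "(('p::finite, 'm::finite) point \<Rightarrow> real ^ 'c) \<Rightarrow> ('p, 'm) point \<Rightarrow> ('p, 'm) point set" where
  "linearized_cone c x = {d. (\<forall>i\<in>active c x. 0 \<le> grad (\<lambda>y. c y $ i) x \<bullet> d) \<and>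
      (\<forall>i\<in>I_0p x. x1 d $ i = 0) \<and> (\<forall>i\<in>I_p0 x. x2 d $ i = 0) \<and>
      (\<forall>i\<in>I_00 x. 0 \<le> x1 d $ i \<and> 0 \<le> x2 d $ i \<and> x1 d $ i * x2 d $ i = 0)}"

lemma not_b_stationary_descent:
  assumes "x \<in> mpec_feasible_set c" "\<not> b_stationary f c x"
  obtains d where "d \<in> linearized_cone c x" "grad f x \<bullet> d < 0"
proof -
  have "b_stationary f c x \<longleftrightarrow> is_arg_min (\<lambda>d. grad f x \<bullet> d) (\<lambda>d. d \<in> linearized_cone c x) 0"
    unfolding b_stationary_def linearized_cone_def
    using assms(1) by (simp add: active_def I_0p_def I_p0_def I_00_def)
  moreover have "0 \<in> linearized_cone c x"
    by (simp add: linearized_cone_def)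
  ultimately show thesis
    using assms(2) that by (auto simp: is_arg_min_def)
qed

lemma complementary_index_cases:
  assumes "complementary x"
  obtains "i \<in> I_0p x" | "i \<in> I_p0 x" | "i \<in> I_00 x"
  using assms unfolding complementary_def I_0p_def I_p0_def I_00_def
  by (metis (mono_tags, lifting) mem_Collect_eq mult_eq_0_iff order_le_less)

lemma eventually_slack_nonneg:
  fixes a b :: real
  assumes "0 < a"
  shows "\<forall>\<^sub>F t in at_right 0. 0 \<le> a + t * b"
proof -
  have "((\<lambda>t. a + t * b) \<longlongrightarrow> a + 0 * b) (at_right 0)"
    by (intro tendsto_intros)
  then have "((\<lambda>t. a + t * b) \<longlongrightarrow> a) (at_right 0)"
    by simp
  from order_tendstoD(1)[OF this assms] show ?thesis
    by (rule eventually_mono) simp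
qed

text \<open>
  Tight constraints are homogeneous along the cone, so they hold for all positive multiples of \<open>d\<close>.
  Each of the finitely many slack constraints, and the trust region, holds for all small ones.
\<close>

lemma eventually_lpec_feasible:
  assumes feas: "x \<in> mpec_feasible_set c" and d: "d \<in> linearized_cone c x" and "0 < \<rho>"
  shows "\<forall>\<^sub>F t in at_right 0. lpec_feasible c x \<rho> (t *\<^sub>R d)"
proof -
  have c_nonneg: "0 \<le> c x $ i" for i
    using feas by (simp add: mpec_feasible_set_def)
  have comp: "complementary x"
    using feas by (simp add: mpec_feasible_set_def)
  have pos: "\<forall>\<^sub>F t in at_right (0::real). 0 < t"
    by (rule eventually_at_right_less)
  have lin: "\<forall>\<^sub>F t in at_right 0. 0 \<le> c x $ i + grad (\<lambda>y. c y $ i) x \<bullet> (t *\<^sub>R d)" for i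
  proof (cases "c x $ i = 0")
    case True
    then have "0 \<le> grad (\<lambda>y. c y $ i) x \<bullet> d"
      using d by (simp add: linearized_cone_def active_def)
    then show ?thesis
      using True by (auto intro: eventually_mono[OF pos])
  next
    case False
    then have "0 < c x $ i"
      using c_nonneg[of i] by simp
    from eventually_slack_nonneg[OF this] show ?thesis
      by simp
  qed
  have compl: "\<forall>\<^sub>F t in at_right 0.
      0 \<le> x1 (x + t *\<^sub>R d) $ i \<and> 0 \<le> x2 (x + t *\<^sub>R d) $ i \<and>
      x1 (x + t *\<^sub>R d) $ i * x2 (x + t *\<^sub>R d) $ i = 0" for i
    using comp
  proof (cases rule: complementary_index_cases[of x i])
    case 1
    then have "x1 x $ i = 0" "x1 d $ i = 0" "0 < x2 x $ i"
      using d by (auto simp: linearized_cone_def I_0p_def)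
    then show ?thesis
      using eventually_slack_nonneg[of "x2 x $ i" "x2 d $ i"] by simp
  next
    case 2
    then have "x2 x $ i = 0" "x2 d $ i = 0" "0 < x1 x $ i"
      using d by (auto simp: linearized_cone_def I_p0_def)
    then show ?thesis
      using eventually_slack_nonneg[of "x1 x $ i" "x1 d $ i"] by simp
  next
    case 3
    then have "x1 x $ i = 0" "x2 x $ i = 0"
      "0 \<le> x1 d $ i" "0 \<le> x2 d $ i" "x1 d $ i * x2 d $ i = 0"
      using d by (auto simp: linearized_cone_def I_00_def)
    then show ?thesis
      by (auto intro: eventually_mono[OF pos])
  qed
  have box: "\<forall>\<^sub>F t in at_right 0. infnorm (t *\<^sub>R d) \<le> \<rho>"
    using pos eventually_slack_nonneg[OF \<open>0 < \<rho>\<close>, of "- infnorm d"]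
    by eventually_elim (simp add: infnorm_mul)
  show ?thesis
    unfolding lpec_feasible_def complementary_def
    by (intro eventually_conj eventually_all_finite lin compl box)
qed

lemma lpec_descent_direction:
  assumes "x \<in> mpec_feasible_set c" "\<not> b_stationary f c x" "0 < \<rho>"
  obtains d where "lpec_feasible c x \<rho> d" "grad f x \<bullet> d < 0"
proof -
  obtain d where d: "d \<in> linearized_cone c x" "grad f x \<bullet> d < 0"
    using not_b_stationary_descent assms by blast
  have "\<forall>\<^sub>F t in at_right 0. lpec_feasible c x \<rho> (t *\<^sub>R d) \<and> 0 < t"
    using eventually_lpec_feasible[OF assms(1) d(1) assms(3)] eventually_at_right_less
    by (rule eventually_conj)
  then obtain t where "lpec_feasible c x \<rho> (t *\<^sub>R d)" "0 < t"
    using eventually_happens'[OF trivial_limit_at_right_real] by blast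
  then show thesis
    using d(2) by (intro that[of "t *\<^sub>R d"]) (auto simp: mult_pos_neg)
qed

section \<open>Branches after a short step\<close>

lemma branch_pairs_zero:
  assumes "(I1, I2) \<in> branch_pairs y"
  shows "i \<in> I1 \<Longrightarrow> x1 y $ i = 0" and "i \<in> I2 \<Longrightarrow> x2 y $ i = 0"
  using assms by (auto simp: branch_pairs_def I_0p_def I_p0_def I_00_def)

text \<open>
  A component that is positive at \<open>x\<close> bounds the radius from above, so a step shorter than the
  radius cannot use it up.
\<close>

lemma zero_after_short_step:
  assumes comp: "complementary x" and short: "ereal (infnorm d) < rho_bar N c x"
  shows "x1 (x + d) $ i = 0 \<Longrightarrow> x1 x $ i = 0" and "x2 (x + d) $ i = 0 \<Longrightarrow> x2 x $ i = 0"
proof -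
  have nonneg: "0 \<le> x1 x $ i" "0 \<le> x2 x $ i" and prod: "x1 x $ i * x2 x $ i = 0"
    using comp by (auto simp: complementary_def)
  show "x1 x $ i = 0" if "x1 (x + d) $ i = 0"
  proof (rule ccontr)
    assume "x1 x $ i \<noteq> 0"
    then have "i \<in> I_p0 x"
      using nonneg prod by (simp add: I_p0_def)
    then have "rho_bar N c x \<le> ereal (x1 x $ i)"
      unfolding rho_bar_def by (intro Inf_lower imageI) blast
    with short have "infnorm d < x1 x $ i"
      by (metis less_ereal.simps(1) order_less_le_trans)
    then show False
      using that abs_x1_le_infnorm[of d i] by simp
  qed
  show "x2 x $ i = 0" if "x2 (x + d) $ i = 0"
  proof (rule ccontr)
    assume "x2 x $ i \<noteq> 0"
    then have "i \<in> I_0p x"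
      using nonneg prod by (simp add: I_0p_def)
    then have "rho_bar N c x \<le> ereal (x2 x $ i)"
      unfolding rho_bar_def by (intro Inf_lower imageI) blast
    with short have "infnorm d < x2 x $ i"
      by (metis less_ereal.simps(1) order_less_le_trans)
    then show False
      using that abs_x2_le_infnorm[of d i] by simp
  qed
qed

lemma bnlp_feasible_after_short_step:
  assumes feas: "x \<in> mpec_feasible_set c" and short: "ereal (infnorm d) < rho_bar N c x"
    and branch: "(I1, I2) \<in> branch_pairs (x + d)"
  shows "nlp_feasible (bnlp f c I1 I2) x"
proof -
  have comp: "complementary x" and "\<forall>i. 0 \<le> c x $ i"
    using feas by (auto simp: mpec_feasible_set_def)
  moreover have "\<forall>i. 0 \<le> x1 x $ i \<and> 0 \<le> x2 x $ i"
    using comp by (simp add: complementary_def)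
  moreover have "\<forall>i\<in>I1. x1 x $ i = 0" "\<forall>i\<in>I2. x2 x $ i = 0"
    using branch_pairs_zero[OF branch] zero_after_short_step[OF comp short] by blast+
  ultimately show ?thesis
    by (auto simp: nlp_feasible_def bnlp_def)
qed

text \<open>
  The step \<open>d\<close> itself is a linearized feasible direction at \<open>x\<close> for the branch that it reaches:
  the components fixed by the branch are zero before and after the step, and an active constraint
  is nonnegative in its linearization after the step, so its gradient is nonnegative along \<open>d\<close>.
\<close>

lemma bnlp_not_stationary_after_short_step:
  assumes feas: "x \<in> mpec_feasible_set c" and short: "ereal (infnorm d) < rho_bar N c x"
    and lpec: "lpec_feasible c x \<rho> d"
    and branch: "(I1, I2) \<in> branch_pairs (x + d)"
    and descent: "grad f x \<bullet> d < 0"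
  shows "\<not> nlp_stationary (bnlp f c I1 I2) x"
proof
  assume stat: "nlp_stationary (bnlp f c I1 I2) x"
  have comp: "complementary x"
    using feas by (simp add: mpec_feasible_set_def)
  have lin: "0 \<le> c x $ i + grad (\<lambda>y. c y $ i) x \<bullet> d" for i
    using lpec by (simp add: lpec_feasible_def)
  have nonneg: "0 \<le> x1 x $ i + x1 d $ i" "0 \<le> x2 x $ i + x2 d $ i" for i
    using lpec by (auto simp: lpec_feasible_def complementary_def)
  have fixed1: "x1 d $ i = 0" if "i \<in> I1" for i
    using branch_pairs_zero(1)[OF branch that] zero_after_short_step(1)[OF comp short, of i] by simp
  have fixed2: "x2 d $ i = 0" if "i \<in> I2" for i
    using branch_pairs_zero(2)[OF branch that] zero_after_short_step(2)[OF comp short, of i] by simp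
  have "0 \<le> grad (objective (bnlp f c I1 I2)) x \<bullet> d"
  proof (rule nlp_stationary_no_descent[OF stat])
    fix k assume "k \<in> eqs (bnlp f c I1 I2)"
    then show "grad (con (bnlp f c I1 I2) k) x \<bullet> d = 0"
      by (auto simp: bnlp_def grad_Comp1_inner grad_Comp2_inner fixed1 fixed2)
  next
    fix k assume k: "con (bnlp f c I1 I2) k x = 0"
    show "0 \<le> grad (con (bnlp f c I1 I2) k) x \<bullet> d"
    proof (cases k)
      case (General i)
      then show ?thesis
        using k lin[of i] by (simp add: bnlp_def grad_General_inner)
    next
      case (Comp1 i)
      then show ?thesis
        using k nonneg(1)[of i] by (simp add: bnlp_def grad_Comp1_inner)
    next
      case (Comp2 i)
      then show ?thesis
        using k nonneg(2)[of i] by (simp add: bnlp_def grad_Comp2_inner)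
    qed
  qed
  then show False
    using descent by (simp add: bnlp_def)
qed

section \<open>Progress at points that are not B-stationary\<close>

theorem corollary4p2:
  fixes f :: "('p::finite, 'm::finite) point \<Rightarrow> real"
    and c :: "('p, 'm) point \<Rightarrow> real ^ 'c::finite"
    and N :: "('p, 'm) point \<Rightarrow> real"
    and S :: "(('p, 'm) point, ('c, 'm) con_index) nlp \<Rightarrow> ('p, 'm) point \<Rightarrow> ('p, 'm) point"
    and xk :: "('p, 'm) point"
  assumes smooth: "C2 f" "C2 c"
    and N: "is_norm N"
    and A1: "\<exists>X. compact X \<and> mpec_feasible_set c \<subseteq> X"
    and A2: "\<forall>x\<in>mpec_feasible_set c. MFCQ (tight_nlp f c x) x"
    and A3: "\<forall>I1 I2. I1 \<union> I2 = UNIV \<and> I1 \<inter> I2 = {} \<longrightarrow> solver_spec S (bnlp f c I1 I2)"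
    and feas: "xk \<in> mpec_feasible_set c"
    and not_stat: "\<not> b_stationary f c xk"
  shows "\<exists>\<rho>0>0. ereal \<rho>0 \<le> rho_bar N c xk \<and> (\<forall>\<rho>. 0 < \<rho> \<and> \<rho> < \<rho>0 \<longrightarrow>
      (\<exists>d. lpec_feasible c xk \<rho> d \<and> d \<noteq> 0 \<and> grad f xk \<bullet> d < 0) \<and>
      (\<forall>d. lpec_solution f c xk \<rho> d \<longrightarrow> d \<noteq> 0 \<and> grad f xk \<bullet> d < 0) \<and>
      (\<forall>d. lpec_feasible c xk \<rho> d \<and> d \<noteq> 0 \<longrightarrow>
        (\<forall>(I1, I2)\<in>branch_pairs (xk + d).
          nlp_feasible (bnlp f c I1 I2) xk \<and>
          (grad f xk \<bullet> d < 0 \<longrightarrow> \<not> nlp_stationary (bnlp f c I1 I2) xk))))"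
proof -
  obtain r where r: "0 < r" "ereal r \<le> rho_bar N c xk"
    using rho_bar_positive_lower_bound[OF N] .
  have descent: "\<exists>d. lpec_feasible c xk \<rho> d \<and> d \<noteq> 0 \<and> grad f xk \<bullet> d < 0" if "0 < \<rho>" for \<rho>
    using lpec_descent_direction[OF feas not_stat that] by (metis inner_zero_right less_irrefl)
  have solution: "d \<noteq> 0 \<and> grad f xk \<bullet> d < 0"
    if pos: "0 < \<rho>" and sol: "lpec_solution f c xk \<rho> d" for \<rho> d
  proof -
    obtain e where "lpec_feasible c xk \<rho> e" "grad f xk \<bullet> e < 0"
      using descent[OF pos] by blast
    then have "grad f xk \<bullet> d < 0"
      using sol unfolding lpec_solution_def is_arg_min_linorder by fastforce
    then show ?thesis
      by auto
  qed
  have branch: "nlp_feasible (bnlp f c I1 I2) xk \<and>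
      (grad f xk \<bullet> d < 0 \<longrightarrow> \<not> nlp_stationary (bnlp f c I1 I2) xk)"
    if "\<rho> < r" "lpec_feasible c xk \<rho> d" "(I1, I2) \<in> branch_pairs (xk + d)" for \<rho> d I1 I2
  proof -
    have "infnorm d < r"
      using that(1,2) by (simp add: lpec_feasible_def)
    then have short: "ereal (infnorm d) < rho_bar N c xk"
      using r(2) by (metis less_ereal.simps(1) order_less_le_trans)
    show ?thesis
      using bnlp_feasible_after_short_step[OF feas short that(3)]
        bnlp_not_stationary_after_short_step[OF feas short that(2,3)] by blast
  qed
  show ?thesis
    using r descent solution branch by (intro exI[of _ r]) blast
qed

end
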